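(* Let $\varepsilon\in(0,1)$ and $\delta>0$. In the multi-armed bandit protocol with $d$ arms, GREEN-IX run with learning parameter $\varepsilon'=\varepsilon/2$ satisfies, with probability at least $1-\delta$, simultaneously for all arms $f\in[d]$, $$(1-\varepsilon)\sum_{t=1}^T\ell^t_{I(t)}-\sum_{t=1}^T\ell_f^t\le\frac{6d\log(d^2/\delta)}{\varepsilon}+d\Big(1+2\ln(2d/\varepsilon)+\log(d^2/\delta)\Big).$$
   Context: **Multi-armed bandit protocol.** There are $d$ arms and $T$ rounds. In each round $t$ the learner picks a distribution $w^t$ on $[d]$; the adversary picks $\ell^t\in[0,1]^d$ (possibly depending on the past, in particular on $I(1),\dots,I(t-1)$, but not on $I(t)$); the learner draws $I(t)\sim w^t$, suffers $\ell^t_{I(t)}$ and observes only $\ell^t_{I(t)}$. **GREEN-IX** with learning parameter $\varepsilon'$: set $\gamma=\frac{\varepsilon'}{d}$, $\eta=\frac{\varepsilon'}{2d}$, $\zeta=\frac{\varepsilon'}{2d}$, and $p_i^1=1/d$. In each round $t$: (1) $F^t=\{i:p_i^t<\gamma\}$ (frozen arms); (2) $w_i^t=0$ if $i\in F^t$ and $w_i^t=p_i^t/(1-\sum_{j\in F^t}p_j^t)$ otherwise; (3) draw $I(t)\sim w^t$; (4) $\widetilde\ell_i^t=\ell_i^t/(w_i^t+\zeta)$ if $i=I(t)$ and $\widetilde\ell_i^t=0$ otherwise; (5) $p_i^{t+1}\propto p_i^t\exp(-\eta\widetilde\ell_i^t)$. *)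

theory Defs
  imports "HOL-Probability.Probability"
begin

text \<open>
  Arms are \<open>0, \<dots>, d - 1\<close> and rounds are \<open>0, \<dots>, T - 1\<close>; round \<open>t\<close> here is the round usually
  numbered \<open>t + 1\<close>. The \<open>\<sigma>\<close>-algebra \<open>F t\<close> is everything determined before the draw in round \<open>t\<close>:
  the earlier draws, the choices made in round \<open>t\<close>, and any private randomness of the adversary.
  Hence \<open>loss t\<close> may depend (even randomly) on the past, and the condition \<open>draw\<close>
  states that, given all this, the arm of round \<open>t\<close> has law \<open>w t\<close>.
\<close>

locale bandit_protocol = prob_space M + filtration "space M" F
  for M :: "'a measure" and F :: "nat \<Rightarrow> 'a measure" +
  fixes d T :: nat
    and loss :: "nat \<Rightarrow> nat \<Rightarrow> 'a \<Rightarrow> real"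
    and w :: "nat \<Rightarrow> nat \<Rightarrow> 'a \<Rightarrow> real"
    and arm :: "nat \<Rightarrow> 'a \<Rightarrow> nat"
  assumes arms_pos: "0 < d"
    and subalg: "subalgebra M (F t)"
    and loss_measurable: "\<lbrakk>t < T; i < d\<rbrakk> \<Longrightarrow> loss t i \<in> borel_measurable (F t)"
    and loss_range: "\<lbrakk>t < T; i < d; \<omega> \<in> space M\<rbrakk> \<Longrightarrow> loss t i \<omega> \<in> {0..1}"
    and w_measurable: "\<lbrakk>t < T; i < d\<rbrakk> \<Longrightarrow> w t i \<in> borel_measurable (F t)"
    and w_nonneg: "\<lbrakk>t < T; i < d; \<omega> \<in> space M\<rbrakk> \<Longrightarrow> 0 \<le> w t i \<omega>"
    and w_sum: "\<lbrakk>t < T; \<omega> \<in> space M\<rbrakk> \<Longrightarrow> (\<Sum>i<d. w t i \<omega>) = 1"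
    and arm_measurable: "t < T \<Longrightarrow> arm t \<in> measurable (F (Suc t)) (count_space UNIV)"
    and arm_range: "\<lbrakk>t < T; \<omega> \<in> space M\<rbrakk> \<Longrightarrow> arm t \<omega> < d"
    and draw: "\<lbrakk>t < T; i < d\<rbrakk> \<Longrightarrow>
      (AE \<omega> in M. real_cond_exp M (F t) (indicat_real {\<omega> \<in> space M. arm t \<omega> = i}) \<omega> = w t i \<omega>)"

text \<open>
  One step of GREEN-IX, with \<open>e\<close> the learning parameter and \<open>p\<close> the current weights. The freezing
  threshold is \<open>\<gamma> = e / d\<close>; the implicit-exploration bias \<open>\<zeta>\<close> (in the loss estimate) and the step
  size \<open>\<eta>\<close> (in the exponential update) are both \<open>e / (2 d)\<close>.
\<close>

definition green_ix_frozen :: "nat \<Rightarrow> real \<Rightarrow> (nat \<Rightarrow> real) \<Rightarrow> nat set" where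
  "green_ix_frozen d e p = {i. i < d \<and> p i < e / real d}"

definition green_ix_play :: "nat \<Rightarrow> real \<Rightarrow> (nat \<Rightarrow> real) \<Rightarrow> nat \<Rightarrow> real" where
  "green_ix_play d e p i =
    (if i \<in> green_ix_frozen d e p then 0
     else p i / (1 - (\<Sum>j\<in>green_ix_frozen d e p. p j)))"

text \<open>The learner only sees the drawn arm \<open>a\<close> and the number \<open>y\<close>, the loss of that arm.\<close>

definition green_ix_estimate :: "nat \<Rightarrow> real \<Rightarrow> (nat \<Rightarrow> real) \<Rightarrow> nat \<Rightarrow> real \<Rightarrow> nat \<Rightarrow> real" where
  "green_ix_estimate d e p a y i =
    (if i = a then y / (green_ix_play d e p i + e / (2 * real d)) else 0)"

definition green_ix_update :: "nat \<Rightarrow> real \<Rightarrow> (nat \<Rightarrow> real) \<Rightarrow> nat \<Rightarrow> real \<Rightarrow> nat \<Rightarrow> real" where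
  "green_ix_update d e p a y i =
    (let q = (\<lambda>j. p j * exp (- (e / (2 * real d)) * green_ix_estimate d e p a y j))
     in q i / (\<Sum>j<d. q j))"

text \<open>The weights at round \<open>t\<close>, from the sequences \<open>a\<close> of draws and \<open>y\<close> of observed losses;
  only the entries before \<open>t\<close> are used.\<close>

primrec green_ix_weights ::
  "nat \<Rightarrow> real \<Rightarrow> (nat \<Rightarrow> nat) \<Rightarrow> (nat \<Rightarrow> real) \<Rightarrow> nat \<Rightarrow> nat \<Rightarrow> real" where
  "green_ix_weights d e a y 0 = (\<lambda>i. 1 / real d)"
| "green_ix_weights d e a y (Suc t) =
    green_ix_update d e (green_ix_weights d e a y t) (a t) (y t)"

definition runs_green_ix ::
  "'a measure \<Rightarrow> nat \<Rightarrow> nat \<Rightarrow> real \<Rightarrow> (nat \<Rightarrow> nat \<Rightarrow> 'a \<Rightarrow> real) \<Rightarrow> (nat \<Rightarrow> nat \<Rightarrow> 'a \<Rightarrow> real) \<Rightarrow>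
    (nat \<Rightarrow> 'a \<Rightarrow> nat) \<Rightarrow> bool" where
  "runs_green_ix M d T e loss w arm \<longleftrightarrow>
    (\<forall>t<T. \<forall>i<d. \<forall>\<omega>\<in>space M.
      w t i \<omega> =
        green_ix_play d e
          (green_ix_weights d e (\<lambda>s. arm s \<omega>) (\<lambda>s. loss s (arm s \<omega>) \<omega>) t) i)"

end

theory Submission imports Defs begin

text \<open>
  On every path along which no frozen arm is drawn, the exponential-weights potential bounds
  \<open>1 - \<epsilon>'\<close> times the learner's loss by the estimated loss of any arm \<open>f\<close> plus a term of order
  \<open>\<epsilon>' / d\<close> times the total estimated loss of all arms. Freezing keeps the estimated loss of every
  arm close to that of \<open>f\<close>, so the extra term is a \<open>1 + O(\<epsilon>')\<close> factor on the estimated loss of \<open>f\<close>.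
  Implicit exploration makes \<open>exp (2 \<zeta> (estimated loss - loss))\<close> a supermartingale for each
  arm, so by Markov's inequality and a union bound over the arms the estimated losses exceed the
  true ones by at most \<open>ln (d / \<delta>) / (2 \<zeta>)\<close>.
\<close>

subsection \<open>Pathwise regret\<close>

text \<open>The difference of the two sides vanishes at \<open>0\<close> and has derivative
  \<open>exp (- x) - 1 + x\<close>, which is nonnegative. It controls the drop of the potential to
  second order.\<close>

lemma one_minus_exp_neg_ge:
  fixes u :: real
  assumes "0 \<le> u"
  shows "u - u\<^sup>2 / 2 \<le> 1 - exp (- u)"
proof -
  define g where "g x = 1 - exp (- x) - x + x\<^sup>2 / 2" for x :: real
  have "g 0 \<le> g u"
  proof (rule DERIV_nonneg_imp_nondecreasing[OF assms])
    fix x :: real assume "0 \<le> x"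
    have "(g has_real_derivative (exp (- x) - 1 + x)) (at x)"
      unfolding g_def by (auto intro!: derivative_eq_intros)
    moreover have "0 \<le> exp (- x) - 1 + x"
      using exp_ge_add_one_self[of "- x"] by simp
    ultimately show "\<exists>D. (g has_real_derivative D) (at x) \<and> 0 \<le> D" by blast
  qed
  then show ?thesis by (simp add: g_def)
qed

text \<open>With \<open>x = 2 * z * l / w\<close>, the inequality
  \<open>2 * x / (2 + x) \<le> ln (1 + x)\<close> gives the claim with bias \<open>z * l\<close> in
  the denominator; since \<open>l \<le> 1\<close>, raising the bias to \<open>z\<close> only shrinks
  the left side. The denominator \<open>w\<close> on the right cancels when averaging over a draw of
  probability \<open>w\<close>.\<close>

lemma exp_ix_le:
  fixes z l w :: real
  assumes "0 < z" and "0 \<le> l" and "l \<le> 1" and "0 < w"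
  shows "exp (2 * z * l / (w + z)) \<le> 1 + 2 * z * l / w"
proof -
  define g where "g x = ln (1 + x) - 2 * x / (2 + x)" for x :: real
  define x where "x = 2 * z * l / w"
  have x: "0 \<le> x" using assms by (simp add: x_def)
  have "g 0 \<le> g x"
  proof (rule DERIV_nonneg_imp_nondecreasing[OF x])
    fix u :: real assume u: "0 \<le> u"
    have "(g has_real_derivative (1 / (1 + u) - 4 / (2 + u)\<^sup>2)) (at u)"
      unfolding g_def using u
      by (auto intro!: derivative_eq_intros simp: field_simps power2_eq_square)
    \<comment> \<open>Cross-multiplied, the two sides differ by exactly
      \<open>u\<^sup>2\<close>.\<close>
    moreover have "4 / (2 + u)\<^sup>2 \<le> 1 / (1 + u)"
      using u by (simp add: divide_simps) (simp add: power2_eq_square algebra_simps)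
    ultimately show "\<exists>D. (g has_real_derivative D) (at u) \<and> 0 \<le> D"
      by (intro exI[of _ "1 / (1 + u) - 4 / (2 + u)\<^sup>2"]) simp
  qed
  then have "2 * x / (2 + x) \<le> ln (1 + x)" by (simp add: g_def)
  moreover have "2 * x / (2 + x) = 2 * z * l / (w + z * l)"
  proof -
    have "x * w = 2 * (z * l)" using assms by (simp add: x_def)
    then have "2 * x * (w + z * l) = 2 * z * l * (2 + x)" by (simp add: algebra_simps)
    moreover have "0 < w + z * l" using assms by (simp add: add_pos_nonneg)
    ultimately show ?thesis using x by (subst frac_eq_eq) auto
  qed
  moreover have "2 * z * l / (w + z) \<le> 2 * z * l / (w + z * l)"
    using assms by (intro divide_left_mono mult_pos_pos add_pos_nonneg) (auto simp: mult_le_cancel_left1)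
  ultimately have "2 * z * l / (w + z) \<le> ln (1 + x)" by linarith
  then show ?thesis using x by (simp add: ln_ge_iff x_def)
qed

text \<open>Probability is removed here: \<open>a\<close> and \<open>y\<close> are one realised
  sequence of draws and observed losses. For GREEN-IX, \<open>a_unfrozen\<close> holds almost
  surely.\<close>

locale green_ix_path =
  fixes d :: nat and e :: real and a :: "nat \<Rightarrow> nat" and y :: "nat \<Rightarrow> real" and T :: nat
  assumes e_pos: "0 < e" and e_less: "e < 1" and d_pos: "0 < d"
    and a_less: "t < T \<Longrightarrow> a t < d"
    and y_nonneg: "t < T \<Longrightarrow> 0 \<le> y t" and y_le: "t < T \<Longrightarrow> y t \<le> 1"
    and a_unfrozen: "t < T \<Longrightarrow> a t \<notin> green_ix_frozen d e (green_ix_weights d e a y t)"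
begin

abbreviation p :: "nat \<Rightarrow> nat \<Rightarrow> real" where
  "p t \<equiv> green_ix_weights d e a y t"

text \<open>One constant serves as both the step size and the implicit-exploration bias.\<close>

definition \<eta> :: real where "\<eta> = e / (2 * real d)"

definition est :: "nat \<Rightarrow> nat \<Rightarrow> real" where
  "est t i = green_ix_estimate d e (p t) (a t) (y t) i"

definition L :: "nat \<Rightarrow> nat \<Rightarrow> real" where
  "L t i = (\<Sum>s<t. est s i)"

definition W :: "nat \<Rightarrow> real" where
  "W t = (\<Sum>i<d. exp (- \<eta> * L t i))"

lemma eta_pos: "0 < \<eta>"
  using e_pos d_pos by (simp add: \<eta>_def)

lemma W_pos: "0 < W t"
  unfolding W_def using d_pos by (intro sum_pos) auto

lemma L_Suc: "L (Suc t) i = L t i + est t i"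
  by (simp add: L_def)

text \<open>The normalisations of successive rounds cancel, since each only rescales all weights by
  a common factor.\<close>

lemma weights_eq: "p t i = exp (- \<eta> * L t i) / W t"
proof (induction t arbitrary: i)
  case 0
  show ?case by (simp add: W_def L_def)
next
  case (Suc t)
  have q: "p t j * exp (- \<eta> * est t j) = exp (- \<eta> * L (Suc t) j) / W t" for j
    by (simp add: Suc.IH L_Suc ring_distribs exp_add[symmetric])
  have "p (Suc t) i = (p t i * exp (- \<eta> * est t i)) / (\<Sum>j<d. p t j * exp (- \<eta> * est t j))"
    by (simp add: green_ix_update_def Let_def est_def \<eta>_def)
  also have "\<dots> = (exp (- \<eta> * L (Suc t) i) / W t) / (W (Suc t) / W t)"
    unfolding q by (simp add: W_def sum_divide_distrib)
  finally show ?case using W_pos[of t] by simp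
qed

lemma weights_pos: "0 < p t i"
  using W_pos by (simp add: weights_eq)

lemma weights_sum: "(\<Sum>i<d. p t i) = 1"
  using W_pos[of t] by (simp add: weights_eq sum_divide_distrib[symmetric]) (simp add: W_def)

text \<open>At most \<open>d\<close> arms are frozen, each of weight below \<open>e / d\<close>.
  Hence renormalising inflates the surviving weights by at most \<open>1 / (1 - e)\<close>.\<close>

lemma frozen_mass: "(\<Sum>j\<in>green_ix_frozen d e (p t). p t j) \<le> e"
proof -
  have sub: "green_ix_frozen d e (p t) \<subseteq> {..<d}"
    by (auto simp: green_ix_frozen_def)
  have "(\<Sum>j\<in>green_ix_frozen d e (p t). p t j) \<le> (\<Sum>j\<in>green_ix_frozen d e (p t). e / d)"
    by (intro sum_mono) (auto simp: green_ix_frozen_def)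
  also have "\<dots> = card (green_ix_frozen d e (p t)) * (e / d)" by simp
  also have "\<dots> \<le> real d * (e / d)"
    using card_mono[OF _ sub] e_pos by (intro mult_right_mono) auto
  finally show ?thesis using d_pos by simp
qed

lemma est_nonneg: assumes "t < T" shows "0 \<le> est t i"
proof -
  have "0 \<le> green_ix_play d e (p t) i"
    using frozen_mass[of t] e_less weights_pos[of t i] by (simp add: green_ix_play_def)
  then show ?thesis
    using y_nonneg[OF assms] e_pos by (auto simp: est_def green_ix_estimate_def)
qed

lemma est_other: "i \<noteq> a t \<Longrightarrow> est t i = 0"
  by (simp add: est_def green_ix_estimate_def)

context
  fixes t assumes t: "t < T"
begin

abbreviation (input) "h \<equiv> est t (a t)"
abbreviation (input) "wa \<equiv> green_ix_play d e (p t) (a t)"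

lemma weight_ge: "e / d \<le> p t (a t)"
  using a_unfrozen[OF t] a_less[OF t] by (auto simp: green_ix_frozen_def)

lemma play_bounds: "p t (a t) \<le> wa" "(1 - e) * wa \<le> p t (a t)"
proof -
  let ?s = "\<Sum>j\<in>green_ix_frozen d e (p t). p t j"
  have s: "0 \<le> ?s" "?s \<le> e"
    using frozen_mass by (auto intro!: sum_nonneg less_imp_le[OF weights_pos])
  have wa: "wa = p t (a t) / (1 - ?s)"
    using a_unfrozen[OF t] by (simp add: green_ix_play_def)
  show "p t (a t) \<le> wa"
    unfolding wa using s e_less weights_pos[of t "a t"]
    by (simp add: field_simps mult_le_cancel_left)
  have "(1 - e) * p t (a t) \<le> (1 - ?s) * p t (a t)"
    using s weights_pos[of t "a t"] by (intro mult_right_mono) auto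
  then show "(1 - e) * wa \<le> p t (a t)"
    unfolding wa using s e_less by (simp add: field_simps)
qed

lemma est_eq: "h * (wa + \<eta>) = y t"
  using play_bounds(1) weights_pos[of t "a t"] eta_pos
  by (simp add: est_def green_ix_estimate_def \<eta>_def[symmetric])

lemma weight_est_le: "p t (a t) * h \<le> 1"
proof -
  have "p t (a t) * h \<le> (wa + \<eta>) * h"
    using play_bounds(1) eta_pos est_nonneg[OF t] by (intro mult_right_mono) auto
  then show ?thesis using est_eq y_le[OF t] by (simp add: mult.commute)
qed

text \<open>By \<open>est_eq\<close>, the bias lowers \<open>wa * h\<close> from \<open>y t\<close>
  to \<open>y t - \<eta> * h\<close>; replacing \<open>wa\<close> by the unnormalised weight costs
  the factor \<open>1 - e\<close>.\<close>

lemma weight_est_ge: "(1 - e) * (y t - \<eta> * h) \<le> p t (a t) * h"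
proof -
  have "y t - \<eta> * h = wa * h" using est_eq by (simp add: algebra_simps)
  then show ?thesis
    using mult_right_mono[OF play_bounds(2) est_nonneg[OF t, of "a t"]] by (simp add: mult.assoc)
qed

text \<open>An unfrozen arm is played with weight at least \<open>e / d\<close>, which is
  \<open>2 * \<eta>\<close>, so the denominator of \<open>h\<close> is at least
  \<open>3 * \<eta>\<close>.\<close>

lemma est_le: "\<eta> * h \<le> 1 / 3"
proof -
  have "3 * \<eta> \<le> wa + \<eta>"
    using weight_ge play_bounds(1) by (simp add: \<eta>_def)
  then have "h * (3 * \<eta>) \<le> h * (wa + \<eta>)"
    using est_nonneg[OF t] by (intro mult_left_mono) auto
  then show ?thesis using est_eq y_le[OF t] by (simp add: mult_ac)
qed

text \<open>The quadratic term of the exponential-weights potential costs half an \<open>\<eta>\<^sup>2 h\<close>, because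
  \<open>p h \<le> 1\<close>; the implicit-exploration bias costs another \<open>\<zeta> \<eta> h = \<eta>\<^sup>2 h\<close>.\<close>

lemma ln_W_Suc:
  "ln (W (Suc t)) \<le> ln (W t) - \<eta> * ((1 - e) * y t - 3 / 2 * \<eta> * h)"
proof -
  let ?u = "\<eta> * h" let ?p = "p t (a t)"
  have h0: "0 \<le> h" using est_nonneg[OF t] .
  have "W (Suc t) = (\<Sum>i<d. W t * (p t i * exp (- \<eta> * est t i)))"
    unfolding W_def[of "Suc t"] using W_pos[of t]
    by (intro sum.cong) (auto simp: weights_eq L_Suc ring_distribs exp_add[symmetric])
  also have "\<dots> = W t * (\<Sum>i<d. p t i * exp (- \<eta> * est t i))"
    by (simp add: sum_distrib_left)
  \<comment> \<open>Only the drawn arm has a nonzero estimate, so this average departs from the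
    total mass \<open>1\<close> in a single term.\<close>
  also have "(\<Sum>i<d. p t i * exp (- \<eta> * est t i))
      = (\<Sum>i<d. p t i - (if i = a t then ?p * (1 - exp (- ?u)) else 0))"
    by (intro sum.cong) (auto simp: est_other algebra_simps)
  also have "\<dots> = 1 - ?p * (1 - exp (- ?u))"
    using a_less[OF t] by (simp add: sum_subtractf weights_sum)
  also have "W t * \<dots> \<le> W t * exp (- (?p * (1 - exp (- ?u))))"
    using W_pos[of t] exp_ge_add_one_self[of "- (?p * (1 - exp (- ?u)))"]
    by (intro mult_left_mono) auto
  finally have "ln (W (Suc t)) \<le> ln (W t * exp (- (?p * (1 - exp (- ?u)))))"
    using W_pos by simp
  then have 1: "ln (W (Suc t)) \<le> ln (W t) - ?p * (1 - exp (- ?u))"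
    using W_pos[of t] by (simp add: ln_mult)
  have "?p * (?u - ?u\<^sup>2 / 2) \<le> ?p * (1 - exp (- ?u))"
    using h0 eta_pos weights_pos[of t "a t"] by (intro mult_left_mono one_minus_exp_neg_ge) auto
  moreover have "?p * (?u - ?u\<^sup>2 / 2) = \<eta> * (?p * h) - \<eta>\<^sup>2 * h / 2 * (?p * h)"
    by (simp add: algebra_simps power2_eq_square)
  moreover have "\<eta>\<^sup>2 * h / 2 * (?p * h) \<le> \<eta>\<^sup>2 * h / 2"
    using weight_est_le h0 by (intro mult_left_le) auto
  moreover have "\<eta> * ((1 - e) * (y t - \<eta> * h)) \<le> \<eta> * (?p * h)"
    using weight_est_ge eta_pos by simp
  moreover have "\<eta> * ((1 - e) * (y t - \<eta> * h)) = \<eta> * ((1 - e) * y t) - (1 - e) * (\<eta>\<^sup>2 * h)"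
    by (simp add: algebra_simps power2_eq_square)
  moreover have "(1 - e) * (\<eta>\<^sup>2 * h) \<le> \<eta>\<^sup>2 * h"
    using e_pos h0 by (intro mult_left_le_one_le) (auto simp: e_less less_imp_le)
  moreover have "\<eta> * ((1 - e) * y t - 3 / 2 * \<eta> * h) = \<eta> * ((1 - e) * y t) - \<eta>\<^sup>2 * h - \<eta>\<^sup>2 * h / 2"
    by (simp add: algebra_simps power2_eq_square)
  ultimately show ?thesis using 1 by linarith
qed

end

text \<open>The per-round decreases telescope from \<open>W 0 = d\<close>.\<close>

lemma ln_W_le:
  assumes "t \<le> T"
  shows "ln (W t) \<le> ln d - \<eta> * (\<Sum>s<t. (1 - e) * y s - 3 / 2 * \<eta> * est s (a s))"
  using assms
proof (induction t)
  case 0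
  show ?case by (simp add: W_def L_def)
next
  case (Suc t)
  then show ?case using ln_W_Suc[of t] by (simp add: ring_distribs)
qed

text \<open>An arm accumulates estimated loss only while unfrozen, that is, while its weight is at least
  \<open>e / d\<close>; that caps how far its estimated cumulative loss can run ahead of any other arm's.\<close>

lemma L_le:
  assumes "t \<le> T" and f: "f < d"
  shows "\<eta> * L t i \<le> \<eta> * L t f + ln (d / e) + 1 / 3"
  using assms(1)
proof (induction t)
  case 0
  have "1 \<le> d / e" using e_pos e_less d_pos by (simp add: field_simps)
  then show ?case by (simp add: L_def)
next
  case (Suc t)
  then have t: "t < T" by simp
  have nn: "0 \<le> \<eta> * est t f" using est_nonneg[OF t] eta_pos by simp
  show ?case
  proof (cases "i = a t")
    case False
    then show ?thesis using Suc nn by (simp add: L_Suc est_other ring_distribs)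
  next
    case True
    \<comment> \<open>Arm \<open>i\<close> is drawn, hence unfrozen: its weight is at least
      \<open>e / d\<close>, while \<open>W t\<close> is at least the single term of
      \<open>f\<close>. This compares the two arms before the round; the new estimate adds at most
      \<open>1 / 3\<close>.\<close>
    have "exp (- \<eta> * L t f) \<le> W t"
      unfolding W_def using f by (intro member_le_sum) auto
    moreover have "e / d * W t \<le> exp (- \<eta> * L t i)"
      using weight_ge[OF t] W_pos[of t] by (simp add: True weights_eq field_simps)
    ultimately have "e / d * exp (- \<eta> * L t f) \<le> exp (- \<eta> * L t i)"
      using e_pos d_pos by (smt (verit) divide_pos_pos mult_left_mono of_nat_0_less_iff)
    then have "ln (e / d * exp (- \<eta> * L t f)) \<le> - \<eta> * L t i"
      using e_pos d_pos by (subst ln_exp[symmetric], subst ln_le_cancel_iff) auto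
    then have "\<eta> * L t i \<le> \<eta> * L t f + ln (d / e)"
      using e_pos d_pos by (simp add: ln_mult ln_div)
    then show ?thesis
      using est_le[OF t] nn by (simp add: True L_Suc ring_distribs)
  qed
qed

lemma regret:
  assumes f: "f < d"
  shows "(1 - e) * (\<Sum>t<T. y t)
    \<le> (1 + 3 / 4 * e) * L T f + 2 * real d * ln d / e + 3 / 2 * real d * (ln (d / e) + 1 / 3)"
proof -
  let ?B = "ln (d / e) + 1 / 3"
  have d\<eta>: "d * \<eta> = e / 2" using d_pos by (simp add: \<eta>_def)
  \<comment> \<open>Each round charges only the drawn arm, so the quadratic cost is the estimated
    loss of all arms together, and \<open>L_le\<close> compares each of them with
    \<open>f\<close>.\<close>
  have "(\<Sum>t<T. est t (a t)) = (\<Sum>t<T. \<Sum>i<d. est t i)"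
  proof (intro sum.cong refl)
    fix t assume "t \<in> {..<T}"
    have "(\<Sum>i<d. est t i) = (\<Sum>i<d. if i = a t then est t (a t) else 0)"
      by (intro sum.cong) (auto simp: est_other)
    then show "est t (a t) = (\<Sum>i<d. est t i)"
      using a_less \<open>t \<in> {..<T}\<close> by simp
  qed
  also have "\<dots> = (\<Sum>i<d. L T i)" unfolding L_def by (rule sum.swap)
  finally have "\<eta> * (\<Sum>t<T. est t (a t)) = (\<Sum>i<d. \<eta> * L T i)"
    by (simp add: sum_distrib_left)
  also have "\<dots> \<le> (\<Sum>i<d. \<eta> * L T f + ?B)"
    using L_le[OF order_refl f] by (intro sum_mono) (simp add: add.assoc)
  \<comment> \<open>Since \<open>d * \<eta> = e / 2\<close>, all \<open>d\<close> arms together cost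
    only a fraction \<open>e / 2\<close> of \<open>L T f\<close>; the weight \<open>3 / 2\<close> of
    this term then yields \<open>3 / 4 * e\<close>.\<close>
  also have "\<dots> = e / 2 * L T f + d * ?B"
    by (simp add: ring_distribs d\<eta>[symmetric])
  finally have S: "\<eta> * (\<Sum>t<T. est t (a t)) \<le> e / 2 * L T f + d * ?B" .
  have "exp (- \<eta> * L T f) \<le> W T"
    unfolding W_def using f by (intro member_le_sum) auto
  then have "- \<eta> * L T f \<le> ln (W T)"
    using W_pos by (simp add: ln_ge_iff)
  also note ln_W_le[OF order_refl]
  also have "(\<Sum>s<T. (1 - e) * y s - 3 / 2 * \<eta> * est s (a s))
     = (1 - e) * (\<Sum>t<T. y t) - 3 / 2 * (\<eta> * (\<Sum>t<T. est t (a t)))"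
    by (simp add: sum_subtractf sum_distrib_left mult.assoc)
  finally have "(1 - e) * (\<Sum>t<T. y t) \<le> L T f + ln d / \<eta> + 3 / 2 * (\<eta> * (\<Sum>t<T. est t (a t)))"
    using eta_pos by (simp add: field_simps)
  moreover have "ln d / \<eta> = 2 * real d * ln d / e" by (simp add: \<eta>_def)
  ultimately show ?thesis using S by (simp add: ring_distribs)
qed

end

subsection \<open>Concentration of the loss estimates\<close>

context bandit_protocol
begin

text \<open>Phrased through the protocol's own \<open>w\<close> and an arbitrary bias
  \<open>z\<close>, so that the concentration argument does not depend on how \<open>w\<close> is
  chosen.\<close>

definition ix_est :: "real \<Rightarrow> nat \<Rightarrow> nat \<Rightarrow> 'a \<Rightarrow> real" where
  "ix_est z t i \<omega> = (if arm t \<omega> = i then loss t i \<omega> / (w t i \<omega> + z) else 0)"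

text \<open>The rate \<open>2 * z\<close> is the one that \<open>exp_ix_le\<close> can
  absorb.\<close>

definition ix_exp :: "real \<Rightarrow> nat \<Rightarrow> nat \<Rightarrow> 'a \<Rightarrow> real" where
  "ix_exp z n i \<omega> = exp (2 * z * ((\<Sum>t<n. ix_est z t i \<omega>) - (\<Sum>t<n. loss t i \<omega>)))"

lemma ix_exp_pos: "0 < ix_exp z n i \<omega>"
  by (simp add: ix_exp_def)

lemma subalgebra_mono: "m \<le> n \<Longrightarrow> subalgebra (F n) (F m)"
  using sets_F_mono by (auto simp: subalgebra_def space_F)

lemma arm_measurable_M [measurable]: "t < T \<Longrightarrow> arm t \<in> measurable M (count_space UNIV)"
  using measurable_from_subalg[OF subalg arm_measurable] .

lemma loss_measurable_M [measurable]: "\<lbrakk>t < T; i < d\<rbrakk> \<Longrightarrow> loss t i \<in> borel_measurable M"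
  using measurable_from_subalg[OF subalg loss_measurable] .

lemma w_measurable_M [measurable]: "\<lbrakk>t < T; i < d\<rbrakk> \<Longrightarrow> w t i \<in> borel_measurable M"
  using measurable_from_subalg[OF subalg w_measurable] .

lemma w_le_1: "\<lbrakk>t < T; i < d; \<omega> \<in> space M\<rbrakk> \<Longrightarrow> w t i \<omega> \<le> 1"
  using w_sum[of t \<omega>] member_le_sum[of i "{..<d}" "\<lambda>i. w t i \<omega>"] w_nonneg[of t _ \<omega>] by auto

text \<open>Conditioning on \<open>F t\<close> replaces the indicator of the draw by its conditional
  law \<open>w\<close>; boundedness of \<open>g\<close> supplies integrability.\<close>

lemma integral_draw:
  assumes t: "t < T" "i < d" and g [measurable]: "g \<in> borel_measurable (F t)"
    and bound: "\<And>\<omega>. \<omega> \<in> space M \<Longrightarrow> \<bar>g \<omega>\<bar> \<le> B"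
  shows "integrable M (\<lambda>\<omega>. g \<omega> * indicat_real {\<omega> \<in> space M. arm t \<omega> = i} \<omega>)"
    and "integrable M (\<lambda>\<omega>. g \<omega> * w t i \<omega>)"
    and "(\<integral>\<omega>. g \<omega> * indicat_real {\<omega> \<in> space M. arm t \<omega> = i} \<omega> \<partial>M) = (\<integral>\<omega>. g \<omega> * w t i \<omega> \<partial>M)"
proof -
  interpret finite_measure_subalgebra M "F t"
    by unfold_locales (rule subalg)
  have gM [measurable]: "g \<in> borel_measurable M"
    using measurable_from_subalg[OF subalg g] .
  note [measurable] = arm_measurable_M[OF t(1)] w_measurable_M[OF t]
  let ?I = "indicat_real {\<omega> \<in> space M. arm t \<omega> = i}"
  have I [measurable]: "?I \<in> borel_measurable M" by measurable
  show int: "integrable M (\<lambda>\<omega>. g \<omega> * ?I \<omega>)"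
  proof (rule integrable_const_bound[of _ B])
    show "AE \<omega> in M. norm (g \<omega> * ?I \<omega>) \<le> B"
      using bound by (intro AE_I2) (force simp: abs_mult indicator_def)
  qed measurable
  show "integrable M (\<lambda>\<omega>. g \<omega> * w t i \<omega>)"
  proof (rule integrable_const_bound[of _ B])
    show "AE \<omega> in M. norm (g \<omega> * w t i \<omega>) \<le> B"
    proof (intro AE_I2)
      fix \<omega> assume \<omega>: "\<omega> \<in> space M"
      have "\<bar>g \<omega>\<bar> * w t i \<omega> \<le> \<bar>g \<omega>\<bar>"
        using w_le_1[OF t \<omega>] by (intro mult_left_le) auto
      then show "norm (g \<omega> * w t i \<omega>) \<le> B"
        using bound[OF \<omega>] w_nonneg[OF t \<omega>] by (simp add: abs_mult)
    qed
  qed measurable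
  have "(\<integral>\<omega>. g \<omega> * ?I \<omega> \<partial>M) = (\<integral>\<omega>. g \<omega> * real_cond_exp M (F t) ?I \<omega> \<partial>M)"
    by (rule real_cond_exp_intg(2)[symmetric, OF int g I])
  also have "\<dots> = (\<integral>\<omega>. g \<omega> * w t i \<omega> \<partial>M)"
    using draw[OF t] by (intro integral_cong_AE) auto
  finally show "(\<integral>\<omega>. g \<omega> * ?I \<omega> \<partial>M) = (\<integral>\<omega>. g \<omega> * w t i \<omega> \<partial>M)" .
qed

text \<open>Frozen arms have weight \<open>0\<close>; the protocol excludes drawing them only up to a null set.\<close>

lemma AE_drawn_weight_nonzero: "AE \<omega> in M. \<forall>t<T. w t (arm t \<omega>) \<omega> \<noteq> 0"
proof -
  have "AE \<omega> in M. arm t \<omega> = i \<longrightarrow> w t i \<omega> \<noteq> 0" if t: "t < T" "i < d" for t i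
  proof -
    let ?I = "indicat_real {\<omega> \<in> space M. arm t \<omega> = i}"
    \<comment> \<open>\<open>?g\<close> marks weight zero, so its product with the weight vanishes
      identically; exchanging weight and indicator makes the event of drawing \<open>i\<close> at
      weight zero null.\<close>
    let ?g = "\<lambda>\<omega>. indicat_real {0} (w t i \<omega>)"
    note [measurable] = w_measurable[OF t]
    have g: "?g \<in> borel_measurable (F t)" by measurable
    note D = integral_draw[OF t g, of 1]
    have "(\<integral>\<omega>. ?g \<omega> * w t i \<omega> \<partial>M) = (\<integral>\<omega>. 0 \<partial>M)"
      by (intro Bochner_Integration.integral_cong) (auto simp: indicator_def)
    then have "(\<integral>\<omega>. ?g \<omega> * ?I \<omega> \<partial>M) = 0"
      using D(3) by (simp add: indicator_def)
    then have "AE \<omega> in M. ?g \<omega> * ?I \<omega> = 0"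
      using D(1) by (subst (asm) integral_nonneg_eq_0_iff_AE) (auto simp: indicator_def)
    then show ?thesis
      by (rule AE_mp) (auto intro!: AE_I2 simp: indicator_def split: if_splits)
  qed
  then have "AE \<omega> in M. \<forall>t\<in>{..<T}. \<forall>i\<in>{..<d}. arm t \<omega> = i \<longrightarrow> w t i \<omega> \<noteq> 0"
    by (intro AE_finite_allI) auto
  then show ?thesis
    by (rule AE_mp) (auto intro!: AE_I2 dest: arm_range)
qed

lemma ix_exp_measurable:
  assumes "n \<le> T" "i < d"
  shows "ix_exp z n i \<in> borel_measurable (F n)"
proof -
  have "arm t \<in> measurable (F n) (count_space UNIV)" if "t < n" for t
    using measurable_from_subalg[OF subalgebra_mono arm_measurable, of t n] that assms by simp
  moreover have "loss t i \<in> borel_measurable (F n)" "w t i \<in> borel_measurable (F n)" if "t < n" for t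
    using measurable_from_subalg[OF subalgebra_mono loss_measurable, of t n i]
      measurable_from_subalg[OF subalgebra_mono w_measurable, of t n i] that assms by simp_all
  ultimately show ?thesis
    unfolding ix_exp_def[abs_def] ix_est_def[abs_def] by measurable
qed

text \<open>Each round adds at most \<open>2\<close> to the exponent, because
  \<open>z * l \<le> w + z\<close> for a loss \<open>l \<le> 1\<close>. The crude bound serves only
  integrability.\<close>

lemma ix_exp_bound:
  assumes z: "0 < z" and n: "n \<le> T" and i: "i < d" and \<omega>: "\<omega> \<in> space M"
  shows "ix_exp z n i \<omega> \<le> exp (2 * real n)"
proof -
  have "z * ((\<Sum>t<n. ix_est z t i \<omega>) - (\<Sum>t<n. loss t i \<omega>))
      = (\<Sum>t<n. z * (ix_est z t i \<omega> - loss t i \<omega>))"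
    by (simp only: sum_subtractf[symmetric] sum_distrib_left)
  also have "\<dots> \<le> (\<Sum>t<n. 1)"
  proof (intro sum_mono)
    fix t assume "t \<in> {..<n}"
    then have t: "t < T" using n by simp
    have l: "0 \<le> loss t i \<omega>" "loss t i \<omega> \<le> 1" using loss_range[OF t i \<omega>] by auto
    have w0: "0 \<le> w t i \<omega>" using w_nonneg[OF t i \<omega>] .
    have "z * loss t i \<omega> \<le> w t i \<omega> + z"
      using w0 mult_left_le[OF l(2), of z] z by linarith
    then have "z * ix_est z t i \<omega> \<le> 1"
      using z w0 by (auto simp: ix_est_def field_simps)
    then show "z * (ix_est z t i \<omega> - loss t i \<omega>) \<le> 1"
      using l z by (smt (verit) mult_left_mono)
  qed
  finally show ?thesis by (simp add: ix_exp_def mult.assoc)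
qed

text \<open>\<open>ix_exp z\<close> is a supermartingale: round \<open>n\<close> multiplies it by
  \<open>exp (- 2 z \<ell>) (1 + c 1{I = i})\<close> with \<open>1 + c w \<le> 1 + 2 z \<ell> \<le> exp (2 z \<ell>)\<close>.\<close>

lemma expectation_ix_exp:
  assumes z: "0 < z" and "n \<le> T" and i: "i < d"
  shows "integrable M (ix_exp z n i)" and "expectation (ix_exp z n i) \<le> 1"
proof -
  have int: "integrable M (ix_exp z n i)" if "n \<le> T" for n
  proof (rule integrable_const_bound[of _ "exp (2 * real n)"])
    show "AE \<omega> in M. norm (ix_exp z n i \<omega>) \<le> exp (2 * real n)"
      using ix_exp_bound[OF z that i] by (intro AE_I2) (simp add: ix_exp_def)
    show "ix_exp z n i \<in> borel_measurable M"
      using measurable_from_subalg[OF subalg ix_exp_measurable[OF that i]] .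
  qed
  then show "integrable M (ix_exp z n i)" using assms by simp
  show "expectation (ix_exp z n i) \<le> 1"
    using \<open>n \<le> T\<close>
  proof (induction n)
    case 0
    show ?case by (simp add: ix_exp_def[abs_def])
  next
    case (Suc n)
    then have n: "n < T" "n \<le> T" by auto
    let ?I = "indicat_real {\<omega> \<in> space M. arm n \<omega> = i}"
    \<comment> \<open>Both \<open>g\<close> and \<open>c\<close> are known before the draw:
      \<open>g\<close> is the next value if \<open>i\<close> is not drawn, and drawing
      \<open>i\<close> multiplies it by \<open>1 + c\<close>.\<close>
    define g where "g \<omega> = ix_exp z n i \<omega> * exp (- 2 * z * loss n i \<omega>)" for \<omega>
    define c where "c \<omega> = exp (2 * z * loss n i \<omega> / (w n i \<omega> + z)) - 1" for \<omega>
    note [measurable] = w_measurable[OF n(1) i] loss_measurable[OF n(1) i]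
      ix_exp_measurable[OF n(2) i]
    have g_meas [measurable]: "g \<in> borel_measurable (F n)" unfolding g_def[abs_def] by measurable
    have c_meas [measurable]: "c \<in> borel_measurable (F n)" unfolding c_def[abs_def] by measurable
    have gc_meas: "(\<lambda>\<omega>. g \<omega> * c \<omega>) \<in> borel_measurable (F n)" by measurable
    have bounds: "0 \<le> g \<omega>" "g \<omega> \<le> exp (2 * real n)" "0 \<le> c \<omega>" "c \<omega> \<le> exp 2"
      "g \<omega> * (1 + c \<omega> * w n i \<omega>) \<le> ix_exp z n i \<omega>"
      if \<omega>: "\<omega> \<in> space M" for \<omega>
    proof -
      have l: "0 \<le> loss n i \<omega>" "loss n i \<omega> \<le> 1" using loss_range[OF n(1) i \<omega>] by auto
      have w0: "0 \<le> w n i \<omega>" using w_nonneg[OF n(1) i \<omega>] .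
      have e0: "0 \<le> ix_exp z n i \<omega>" by (simp add: ix_exp_def)
      show "0 \<le> g \<omega>" by (simp add: g_def ix_exp_def)
      have "g \<omega> \<le> ix_exp z n i \<omega>"
        unfolding g_def using l z e0 by (intro mult_left_le) auto
      then show "g \<omega> \<le> exp (2 * real n)" using ix_exp_bound[OF z n(2) i \<omega>] by simp
      show "0 \<le> c \<omega>" using l w0 z by (simp add: c_def)
      have "z * loss n i \<omega> \<le> w n i \<omega> + z"
        using w0 mult_left_le[OF l(2) less_imp_le[OF z]] by linarith
      then have "2 * z * loss n i \<omega> \<le> 2 * (w n i \<omega> + z)"
        by (simp only: mult.assoc mult_le_cancel_left_pos zero_less_numeral)
      then have "2 * z * loss n i \<omega> / (w n i \<omega> + z) \<le> 2"
        using w0 z by (simp only: pos_divide_le_eq add_nonneg_pos)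
      then have "exp (2 * z * loss n i \<omega> / (w n i \<omega> + z)) \<le> exp 2" by simp
      then show "c \<omega> \<le> exp 2" by (simp only: c_def)
      have "1 + c \<omega> * w n i \<omega> \<le> 1 + 2 * z * loss n i \<omega>"
      \<comment> \<open>\<open>exp_ix_le\<close> needs positive weight; at weight zero the product
        with \<open>c\<close> vanishes.\<close>
      proof (cases "w n i \<omega> = 0")
        case True
        then show ?thesis using l z by simp
      next
        case False
        then have "c \<omega> \<le> 2 * z * loss n i \<omega> / w n i \<omega>"
          unfolding c_def using exp_ix_le[of z "loss n i \<omega>" "w n i \<omega>"] l w0 z by simp
        then show ?thesis using False w0 by (simp add: field_simps)
      qed
      also have "\<dots> \<le> exp (2 * z * loss n i \<omega>)" by (rule exp_ge_add_one_self)
      finally have "g \<omega> * (1 + c \<omega> * w n i \<omega>) \<le> g \<omega> * exp (2 * z * loss n i \<omega>)"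
        using \<open>0 \<le> g \<omega>\<close> by (rule mult_left_mono)
      also have "\<dots> = ix_exp z n i \<omega>" by (simp add: g_def exp_minus)
      finally show "g \<omega> * (1 + c \<omega> * w n i \<omega>) \<le> ix_exp z n i \<omega>" .
    qed
    have "\<bar>g \<omega> * c \<omega>\<bar> \<le> exp (2 * real n) * exp 2" if "\<omega> \<in> space M" for \<omega>
      using bounds[OF that] by (auto simp: abs_mult intro!: mult_mono)
    note D = integral_draw[OF n(1) i gc_meas this]
    have g_int: "integrable M g"
    proof (rule integrable_const_bound[of _ "exp (2 * real n)"])
      show "AE \<omega> in M. norm (g \<omega>) \<le> exp (2 * real n)" using bounds by (intro AE_I2) auto
      show "g \<in> borel_measurable M" using measurable_from_subalg[OF subalg g_meas] .
    qed
    have "expectation (ix_exp z (Suc n) i) = (\<integral>\<omega>. g \<omega> + g \<omega> * c \<omega> * ?I \<omega> \<partial>M)"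
    proof (intro Bochner_Integration.integral_cong refl)
      fix \<omega> assume "\<omega> \<in> space M"
      then show "ix_exp z (Suc n) i \<omega> = g \<omega> + g \<omega> * c \<omega> * ?I \<omega>"
        by (auto simp: ix_exp_def g_def c_def ix_est_def indicator_def exp_add[symmetric] algebra_simps)
    qed
    \<comment> \<open>\<open>integral_draw\<close> turns the indicator into \<open>w\<close>, after
      which the pointwise bound on \<open>g * (1 + c * w)\<close> applies.\<close>
    also have "\<dots> = (\<integral>\<omega>. g \<omega> \<partial>M) + (\<integral>\<omega>. g \<omega> * c \<omega> * w n i \<omega> \<partial>M)"
      using g_int D by simp
    also have "\<dots> = (\<integral>\<omega>. g \<omega> + g \<omega> * c \<omega> * w n i \<omega> \<partial>M)"
      using g_int D by simp
    also have "\<dots> \<le> expectation (ix_exp z n i)"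
      using g_int D(2) int[OF n(2)] bounds(5)
      by (intro integral_mono) (auto simp: algebra_simps)
    finally show ?case using Suc.IH n by simp
  qed
qed

text \<open>Markov's inequality for \<open>ix_exp\<close> at level \<open>1 / r\<close>, read off
  after taking logarithms.\<close>

lemma prob_ix_est_deviation:
  assumes z: "0 < z" and i: "i < d" and r: "0 < r"
  shows "prob {\<omega> \<in> space M. (\<Sum>t<T. loss t i \<omega>) + ln (1 / r) / (2 * z) \<le> (\<Sum>t<T. ix_est z t i \<omega>)} \<le> r"
proof -
  have "{\<omega> \<in> space M. (\<Sum>t<T. loss t i \<omega>) + ln (1 / r) / (2 * z) \<le> (\<Sum>t<T. ix_est z t i \<omega>)}
      = {\<omega> \<in> space M. 1 / r \<le> ix_exp z T i \<omega>}"
  proof (intro Collect_cong conj_cong refl)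
    fix \<omega>
    have "1 / r \<le> ix_exp z T i \<omega> \<longleftrightarrow> ln (1 / r) \<le> ln (ix_exp z T i \<omega>)"
      using r by (subst ln_le_cancel_iff) (auto simp: ix_exp_def)
    then show "(\<Sum>t<T. loss t i \<omega>) + ln (1 / r) / (2 * z) \<le> (\<Sum>t<T. ix_est z t i \<omega>)
        \<longleftrightarrow> 1 / r \<le> ix_exp z T i \<omega>"
      using z by (simp add: ix_exp_def field_simps)
  qed
  also have "prob \<dots> \<le> expectation (ix_exp z T i) / (1 / r)"
    using r expectation_ix_exp(1)[OF z order_refl i]
    by (intro integral_Markov_inequality_measure[where A="{}"]) (auto intro: less_imp_le[OF ix_exp_pos])
  also have "\<dots> \<le> r"
    using r expectation_ix_exp(2)[OF z order_refl i] by simp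
  finally show ?thesis .
qed

lemma ix_est_measurable:
  assumes "t < T" "i < d"
  shows "ix_est z t i \<in> borel_measurable M"
proof -
  note [measurable] = arm_measurable_M[OF assms(1)] loss_measurable_M[OF assms] w_measurable_M[OF assms]
  show ?thesis unfolding ix_est_def[abs_def] by measurable
qed

lemma drawn_loss_measurable:
  assumes t: "t < T"
  shows "(\<lambda>\<omega>. loss t (arm t \<omega>) \<omega>) \<in> borel_measurable M"
proof -
  \<comment> \<open>The random index is resolved by a finite sum over the possible arms.\<close>
  have "(\<lambda>\<omega>. \<Sum>i<d. if arm t \<omega> = i then loss t i \<omega> else 0) \<in> borel_measurable M"
  proof (intro borel_measurable_sum)
    fix i assume "i \<in> {..<d}"
    then have "i < d" by simp
    note [measurable] = arm_measurable_M[OF t] loss_measurable_M[OF t this]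
    show "(\<lambda>\<omega>. if arm t \<omega> = i then loss t i \<omega> else 0) \<in> borel_measurable M"
      by measurable
  qed
  moreover have "(\<Sum>i<d. if arm t \<omega> = i then loss t i \<omega> else 0) = loss t (arm t \<omega>) \<omega>"
    if "\<omega> \<in> space M" for \<omega>
    using arm_range[OF t that] by simp
  ultimately show ?thesis by (simp cong: measurable_cong)
qed

lemma prob_all_ix_est:
  assumes z: "0 < z" and \<delta>: "0 < \<delta>"
  shows "prob {\<omega> \<in> space M. \<forall>i<d.
      (\<Sum>t<T. ix_est z t i \<omega>) < (\<Sum>t<T. loss t i \<omega>) + ln (d / \<delta>) / (2 * z)} \<ge> 1 - \<delta>"
proof -
  let ?B = "\<lambda>i. {\<omega> \<in> space M. (\<Sum>t<T. loss t i \<omega>) + ln (d / \<delta>) / (2 * z) \<le> (\<Sum>t<T. ix_est z t i \<omega>)}"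
  have B: "?B i \<in> events" if "i < d" for i
  proof -
    note [measurable] = loss_measurable_M[OF _ that] ix_est_measurable[OF _ that]
    show ?thesis by measurable
  qed
  have "prob (\<Union>i<d. ?B i) \<le> (\<Sum>i<d. prob (?B i))"
    using B by (intro finite_measure_subadditive_finite) auto
  \<comment> \<open>Each arm receives failure probability \<open>\<delta> / d\<close>, which is why
    the deviation carries \<open>ln (d / \<delta>)\<close>.\<close>
  also have "\<dots> \<le> (\<Sum>i<d. \<delta> / d)"
    using prob_ix_est_deviation[OF z, of _ "\<delta> / d"] \<delta> arms_pos by (intro sum_mono) auto
  also have "\<dots> = \<delta>" using arms_pos by simp
  finally have "1 - \<delta> \<le> prob (space M - (\<Union>i<d. ?B i))"
    using B by (subst prob_compl) auto
  also have "space M - (\<Union>i<d. ?B i) = {\<omega> \<in> space M. \<forall>i<d.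
      (\<Sum>t<T. ix_est z t i \<omega>) < (\<Sum>t<T. loss t i \<omega>) + ln (d / \<delta>) / (2 * z)}"
    by auto
  finally show ?thesis .
qed

end

section \<open>Arithmetic of the final constants\<close>

lemma green_ix_bound_arith:
  fixes \<epsilon> \<delta> A Lf Le :: real and d :: nat
  assumes \<epsilon>: "0 < \<epsilon>" "\<epsilon> < 1" and \<delta>: "0 < \<delta>" "\<delta> < 1" and d: "0 < d" and A: "0 \<le> A"
    and regret: "(1 - \<epsilon> / 2) * A
      \<le> (1 + 3 / 4 * (\<epsilon> / 2)) * Le + 2 * real d * ln d / (\<epsilon> / 2) + 3 / 2 * real d * (ln (d / (\<epsilon> / 2)) + 1 / 3)"
    and conc: "Le \<le> Lf + ln (d / \<delta>) / (2 * ((\<epsilon> / 2) / (2 * real d)))"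
  shows "(1 - \<epsilon>) * A - Lf
    \<le> 6 * real d * ln ((real d)\<^sup>2 / \<delta>) / \<epsilon> + real d * (1 + 2 * ln (2 * real d / \<epsilon>) + ln ((real d)\<^sup>2 / \<delta>))"
proof -
  define k where "k = 1 + 3 / 8 * \<epsilon>"
  define x where "x = ln (real d)"
  define v where "v = ln (1 / \<delta>)"
  define u where "u = ln (2 * real d / \<epsilon>)"
  have k: "1 \<le> k" using \<epsilon> by (simp add: k_def)
  have x: "0 \<le> x" using d by (simp add: x_def)
  have v: "0 \<le> v" using \<delta> by (simp add: v_def)
  have "\<epsilon> \<le> 2 * real d" using \<epsilon> d by linarith
  then have u: "0 \<le> u" using \<epsilon> by (simp add: u_def)
  have lnd: "ln (d / \<delta>) = x + v" "ln ((real d)\<^sup>2 / \<delta>) = 2 * x + v"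
    using d \<delta> by (simp_all add: x_def v_def ln_div ln_realpow)
  have conc': "Le \<le> Lf + 2 * (d * (x + v) / \<epsilon>)"
  proof -
    have "ln (d / \<delta>) / (2 * (\<epsilon> / 2 / (2 * real d))) = 2 * (d * (x + v) / \<epsilon>)"
      using \<epsilon> d by (simp add: lnd field_simps)
    with conc show ?thesis by (simp only:)
  qed
  define R where "R = 4 * (d * x / \<epsilon>) + 3 / 2 * (d * u) + d / 2"
  have R: "0 \<le> R" using x u \<epsilon> by (simp add: R_def)
  \<comment> \<open>The slack between \<open>1 - \<epsilon> / 2\<close> and
    \<open>1 - \<epsilon>\<close> pays for the factor \<open>k\<close> on the estimated loss: the
    product is \<open>1 - 5/8 \<epsilon> - 3/8 \<epsilon>^2\<close>.\<close>
  have "(1 - \<epsilon>) * k \<le> 1 - \<epsilon> / 2"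
    using \<epsilon> by (simp add: k_def algebra_simps)
  then have "(1 - \<epsilon>) * k * A \<le> (1 - \<epsilon> / 2) * A" using A by (rule mult_right_mono)
  also have "\<dots> \<le> k * Le + R"
  proof -
    have "2 * real d * ln d / (\<epsilon> / 2) + 3 / 2 * real d * (ln (d / (\<epsilon> / 2)) + 1 / 3) = R"
      by (simp add: R_def x_def u_def ring_distribs mult.commute)
    moreover have "1 + 3 / 4 * (\<epsilon> / 2) = k" by (simp add: k_def)
    ultimately show ?thesis using regret by (simp only: add.assoc)
  qed
  \<comment> \<open>Enlarging \<open>R\<close> to \<open>k * R\<close> makes \<open>k\<close> a
    common factor, to be divided out.\<close>
  also have "\<dots> \<le> k * (Lf + 2 * (d * (x + v) / \<epsilon>)) + k * R"
    using mult_right_mono[OF k R] k by (intro add_mono mult_left_mono conc') auto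
  finally have "k * ((1 - \<epsilon>) * A) \<le> k * (Lf + 2 * (d * (x + v) / \<epsilon>) + R)"
    by (simp only: ring_distribs mult_ac)
  then have "(1 - \<epsilon>) * A \<le> Lf + 2 * (d * (x + v) / \<epsilon>) + R"
    using k by (simp only: mult_le_cancel_left_pos)
  moreover have "0 \<le> d * x / \<epsilon>" "0 \<le> d * v / \<epsilon>" "0 \<le> d * u" "0 \<le> d * x" "0 \<le> d * v"
    using x u v \<epsilon> by auto
  moreover have "2 * (d * (x + v) / \<epsilon>) = 2 * (d * x / \<epsilon>) + 2 * (d * v / \<epsilon>)"
    by (simp add: ring_distribs add_divide_distrib)
  moreover have "6 * real d * (2 * x + v) / \<epsilon> = 12 * (d * x / \<epsilon>) + 6 * (d * v / \<epsilon>)"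
    by (simp add: ring_distribs add_divide_distrib)
  moreover have "d * (1 + 2 * u + (2 * x + v)) = d + 2 * (d * u) + 2 * (d * x) + d * v"
    by (simp add: ring_distribs)
  \<comment> \<open>The total is
    \<open>6 d x / \<epsilon> + 2 d v / \<epsilon> + 3/2 d u + d/2\<close>, dominated term by term
    by the stated bound.\<close>
  ultimately show ?thesis unfolding lnd u_def[symmetric] R_def by linarith
qed

section \<open>From single trajectories to the probability bound\<close>

theorem theorem4p1:
  fixes M :: "'a measure" and F :: "nat \<Rightarrow> 'a measure"
    and d T :: nat and \<epsilon> \<delta> :: real
    and loss w :: "nat \<Rightarrow> nat \<Rightarrow> 'a \<Rightarrow> real"
    and arm :: "nat \<Rightarrow> 'a \<Rightarrow> nat"
  assumes "0 < \<epsilon>" and "\<epsilon> < 1" and "0 < \<delta>"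
    and "bandit_protocol M F d T loss w arm"
    and "runs_green_ix M d T (\<epsilon> / 2) loss w arm"
  shows "measure M {\<omega> \<in> space M. \<forall>f<d.
      (1 - \<epsilon>) * (\<Sum>t<T. loss t (arm t \<omega>) \<omega>) - (\<Sum>t<T. loss t f \<omega>)
        \<le> 6 * real d * ln ((real d)\<^sup>2 / \<delta>) / \<epsilon>
          + real d * (1 + 2 * ln (2 * real d / \<epsilon>) + ln ((real d)\<^sup>2 / \<delta>))}
    \<ge> 1 - \<delta>"
proof (cases "\<delta> < 1")
  \<comment> \<open>The claim is trivial here; in the other case \<open>ln (1 / \<delta>)\<close> is
    nonnegative, as the arithmetic requires.\<close>
  case False
  then have "1 - \<delta> \<le> 0" by simp
  then show ?thesis using measure_nonneg order_trans by blast
next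
  case \<delta>1: True
  interpret bandit_protocol M F d T loss w arm by fact
  define z where "z = \<epsilon> / 2 / (2 * real d)"
  have z: "0 < z" using assms(1) arms_pos by (simp add: z_def)
  let ?good = "{\<omega> \<in> space M. \<forall>i<d.
      (\<Sum>t<T. ix_est z t i \<omega>) < (\<Sum>t<T. loss t i \<omega>) + ln (d / \<delta>) / (2 * z)}"
  let ?goal = "{\<omega> \<in> space M. \<forall>f<d.
      (1 - \<epsilon>) * (\<Sum>t<T. loss t (arm t \<omega>) \<omega>) - (\<Sum>t<T. loss t f \<omega>)
        \<le> 6 * real d * ln ((real d)\<^sup>2 / \<delta>) / \<epsilon>
          + real d * (1 + 2 * ln (2 * real d / \<epsilon>) + ln ((real d)\<^sup>2 / \<delta>))}"
  have "1 - \<delta> \<le> prob ?good"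
    by (rule prob_all_ix_est[OF z assms(3)])
  also have "\<dots> \<le> prob ?goal"
  \<comment> \<open>The inclusion is shown off the null set of paths that draw an arm of weight
    zero.\<close>
  proof (rule finite_measure_mono_AE)
    have good: "\<omega> \<in> ?goal" if \<omega>: "\<omega> \<in> ?good" and nz: "\<forall>t<T. w t (arm t \<omega>) \<omega> \<noteq> 0" for \<omega>
    proof -
      let ?a = "\<lambda>s. arm s \<omega>" and ?y = "\<lambda>s. loss s (arm s \<omega>) \<omega>"
      from \<omega> have \<omega>M: "\<omega> \<in> space M" by simp
      have w: "w t i \<omega> = green_ix_play d (\<epsilon> / 2) (green_ix_weights d (\<epsilon> / 2) ?a ?y t) i"
        if "t < T" "i < d" for t i
        using assms(5) \<omega>M that by (auto simp: runs_green_ix_def)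
      have y: "0 \<le> ?y t" "?y t \<le> 1" if "t < T" for t
        using loss_range[OF that arm_range[OF that \<omega>M] \<omega>M] by auto
      interpret green_ix_path d "\<epsilon> / 2" ?a ?y T
      proof
        fix t assume t: "t < T"
        show "arm t \<omega> \<notin> green_ix_frozen d (\<epsilon> / 2) (green_ix_weights d (\<epsilon> / 2) ?a ?y t)"
          using nz[rule_format, OF t] w[OF t arm_range[OF t \<omega>M]] by (auto simp: green_ix_play_def)
      qed (use assms(1,2) arms_pos arm_range \<omega>M y in auto)
      \<comment> \<open>The two estimators agree because \<open>w\<close> is the GREEN-IX play along
        this path and \<open>z\<close> equals its bias.\<close>
      have L: "L T f = (\<Sum>t<T. ix_est z t f \<omega>)" if "f < d" for f
        unfolding L_def using that
        by (intro sum.cong) (auto simp: est_def ix_est_def green_ix_estimate_def w z_def)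
      have "0 \<le> (\<Sum>t<T. ?y t)" using y by (intro sum_nonneg) auto
      note bound = green_ix_bound_arith[OF assms(1-3) \<delta>1 arms_pos this regret]
      show ?thesis
      proof (intro CollectI conjI \<omega>M allI impI)
        fix f assume f: "f < d"
        have "L T f \<le> (\<Sum>t<T. loss t f \<omega>) + ln (d / \<delta>) / (2 * (\<epsilon> / 2 / (2 * real d)))"
          using \<omega> f unfolding L[OF f] z_def by (auto intro: less_imp_le)
        from bound[OF f this]
        show "(1 - \<epsilon>) * (\<Sum>t<T. loss t (arm t \<omega>) \<omega>) - (\<Sum>t<T. loss t f \<omega>)
          \<le> 6 * real d * ln ((real d)\<^sup>2 / \<delta>) / \<epsilon>
            + real d * (1 + 2 * ln (2 * real d / \<epsilon>) + ln ((real d)\<^sup>2 / \<delta>))"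
          .
      qed
    qed
    from AE_drawn_weight_nonzero show "AE \<omega> in M. \<omega> \<in> ?good \<longrightarrow> \<omega> \<in> ?goal"
      by eventually_elim (rule impI, rule good)
    note [measurable] = drawn_loss_measurable loss_measurable_M
    have "{\<omega> \<in> space M. \<forall>f\<in>{..<d}.
      (1 - \<epsilon>) * (\<Sum>t<T. loss t (arm t \<omega>) \<omega>) - (\<Sum>t<T. loss t f \<omega>)
        \<le> 6 * real d * ln ((real d)\<^sup>2 / \<delta>) / \<epsilon>
          + real d * (1 + 2 * ln (2 * real d / \<epsilon>) + ln ((real d)\<^sup>2 / \<delta>))} \<in> events"
      by measurable
    then show "?goal \<in> events" by (simp add: Ball_def)
  qed
  finally show ?thesis .
qed

end
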